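(* Let $m$ be a positive integer and let $n,\ell$ be nonnegative integers. Let $$R_n=\frac1{(n!)^m}\bigl(z^n(z-1)^n\partial_z^n\bigr)^m\in\mathbb{Q}[z,\partial_z],$$ and define $$P_{n,\ell}(z)=\bigl(R_n^*\cdot t^\ell\bigr)\big|_{t=z},\qquad Q_{n,s,\ell}(z)=\varphi_s\!\left(\frac{P_{n,\ell}(z)-P_{n,\ell}(t)}{z-t}\right)\quad(1\le s\le m).$$ Then $(P_{n,\ell},Q_{n,1,\ell},\ldots,Q_{n,m,\ell})$ is a weight $n$ Padé-type approximant of $$\bigl(\log(1-1/z),\ldots,\log^m(1-1/z)\bigr).$$
   Context: $\log(1-1/z)=-\sum_{k\ge1}\frac{1}{k z^k}\in\frac1z\mathbb{Q}[[1/z]]$ and $\log^s(1-1/z)$ is its $s$-th power. For $f=\sum_{k\ge0}f_kz^{-k-1}\in\frac1z\mathbb{Q}[[1/z]]$, $\varphi_f:\mathbb{Q}[t]\to\mathbb{Q}$ is the $\mathbb{Q}$-linear map $t^k\mapsto f_k$, extended $\mathbb{Q}[z]$-linearly to $\mathbb{Q}[z][t]$; $\varphi_s:=\varphi_f$ for $f=\log^s(1-1/z)$. $\mathbb{Q}[z,\partial_z]$ is the Weyl algebra; the formal adjoint of $R=\sum_jP_j(z)\partial_z^j$ is $R^*=\sum_j(-1)^j\partial_t^jP_j(t)\in\mathbb{Q}[t,\partial_t]$, acting on $\mathbb{Q}[t]$. The order is $\mathrm{ord}_\infty(\sum_ka_kz^{-k})=\min\{k:a_k\ne0\}$. A tuple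 $(P,Q_1,\ldots,Q_m)\in\mathbb{Q}[z]^{m+1}$ is a weight $n$ Padé-type approximant of $(f_1,\ldots,f_m)$ if, for some integer $D\ge mn$, $\deg P\le D$ and $\mathrm{ord}_\infty(Pf_j-Q_j)\ge n+1$ for all $1\le j\le m$. *)

theory Defs
  imports
    "HOL-Computational_Algebra.Computational_Algebra"
    "HOL-Library.Extended"
begin

section \<open>The Weyl algebra over the rationals\<close>

text \<open>
  An operator \<open>\<Sum>j. P\<^sub>j(z) \<partial>\<^sup>j\<close> is stored as its normal form, i.e. as the polynomial in \<open>\<partial>\<close>
  whose \<open>j\<close>-th coefficient \<open>P\<^sub>j\<close> is written to the left of \<open>\<partial>\<^sup>j\<close>.
\<close>

typedef weyl = "UNIV :: rat poly poly set"
  morphisms weyl_nf Weyl ..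

text \<open>Left multiplication by \<open>\<partial>\<close>, from \<open>\<partial> q \<partial>\<^sup>j = q \<partial>\<^sup>j\<^sup>+\<^sup>1 + q' \<partial>\<^sup>j\<close>.\<close>

definition nf_D :: "rat poly poly \<Rightarrow> rat poly poly" where
  "nf_D B = pCons 0 B + map_poly pderiv B"

definition nf_times :: "rat poly poly \<Rightarrow> rat poly poly \<Rightarrow> rat poly poly" where
  "nf_times A B = (\<Sum>i\<le>degree A. smult (coeff A i) ((nf_D ^^ i) B))"

lemma map_poly_pderiv_add:
  "map_poly pderiv (A + B) = map_poly pderiv A + map_poly pderiv (B :: rat poly poly)"
  by (rule poly_eqI) (simp add: coeff_map_poly pderiv_add)

lemma nf_D_0 [simp]: "nf_D 0 = 0"
  by (simp add: nf_D_def)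

lemma nf_D_add: "nf_D (A + B) = nf_D A + nf_D B"
  using add_pCons[of 0 A 0 B] by (simp add: nf_D_def map_poly_pderiv_add)

lemma nf_D_smult: "nf_D (smult p B) = smult p (nf_D B) + smult (pderiv p) B"
proof -
  have "map_poly pderiv (smult p B) = smult p (map_poly pderiv B) + smult (pderiv p) B"
    by (rule poly_eqI) (simp add: coeff_map_poly pderiv_mult mult.commute)
  thus ?thesis by (simp add: nf_D_def smult_add_right)
qed

lemma nf_D_pCons: "nf_D (pCons a A) = pCons (pderiv a) ([:a:] + nf_D A)"
  by (rule poly_eqI) (auto simp: nf_D_def coeff_map_poly coeff_pCons split: nat.splits)

lemma nf_times_0_left [simp]: "nf_times 0 B = 0"
  by (simp add: nf_times_def)

lemma nf_times_pCons: "nf_times (pCons a A) B = smult a B + nf_times A (nf_D B)"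
proof (cases "A = 0")
  case False
  thus ?thesis
    by (simp add: nf_times_def sum.atMost_Suc_shift funpow_Suc_right
        del: sum.atMost_Suc funpow.simps)
qed (simp add: nf_times_def)

lemma nf_times_add_right: "nf_times A (B + C) = nf_times A B + nf_times A C"
  by (induction A arbitrary: B C)
     (auto simp: nf_times_pCons smult_add_right nf_D_add algebra_simps)

lemma nf_times_add_left: "nf_times (A + B) C = nf_times A C + nf_times B C"
  by (induction A B arbitrary: C rule: poly_induct2)
     (auto simp: nf_times_pCons smult_add_left)

lemma nf_times_smult_left: "nf_times (smult c A) B = smult c (nf_times A B)"
  by (induction A arbitrary: B) (auto simp: nf_times_pCons smult_add_right)

lemma nf_times_const_left [simp]: "nf_times [:a:] B = smult a B"
  by (simp add: nf_times_pCons)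

lemma nf_times_nf_D_left: "nf_times (nf_D A) B = nf_D (nf_times A B)"
  by (induction A arbitrary: B)
     (auto simp: nf_D_pCons nf_times_pCons nf_times_add_left nf_D_add nf_D_smult algebra_simps)

lemma nf_times_assoc: "nf_times (nf_times A B) C = nf_times A (nf_times B C)"
  by (induction A arbitrary: B)
     (auto simp: nf_times_pCons nf_times_add_left nf_times_smult_left nf_times_nf_D_left)

lemma nf_D_pow_1: "(nf_D ^^ i) 1 = monom 1 i"
  by (induction i)
     (auto simp: nf_D_def monom_Suc map_poly_monom monom_0 one_pCons)

lemma nf_times_1_right: "nf_times A 1 = A"
  by (simp add: nf_times_def nf_D_pow_1 smult_monom poly_as_sum_of_monoms)

instantiation weyl :: ring_1
begin

definition zero_weyl :: weyl where "0 = Weyl 0"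
definition one_weyl :: weyl where "1 = Weyl 1"
definition plus_weyl :: "weyl \<Rightarrow> weyl \<Rightarrow> weyl" where "R + S = Weyl (weyl_nf R + weyl_nf S)"
definition minus_weyl :: "weyl \<Rightarrow> weyl \<Rightarrow> weyl" where "R - S = Weyl (weyl_nf R - weyl_nf S)"
definition uminus_weyl :: "weyl \<Rightarrow> weyl" where "- R = Weyl (- weyl_nf R)"
definition times_weyl :: "weyl \<Rightarrow> weyl \<Rightarrow> weyl" where
  "R * S = Weyl (nf_times (weyl_nf R) (weyl_nf S))"

lemmas weyl_ops = zero_weyl_def one_weyl_def plus_weyl_def minus_weyl_def uminus_weyl_def
  times_weyl_def

instance
proof
  fix R S T :: weyl
  show "R * S * T = R * (S * T)"
    by (simp add: weyl_ops Weyl_inverse nf_times_assoc)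
  show "1 * R = R"
    using nf_times_const_left[of 1 "weyl_nf R"]
    by (simp add: weyl_ops Weyl_inverse weyl_nf_inverse pCons_one)
  show "R * 1 = R"
    by (simp add: weyl_ops Weyl_inverse weyl_nf_inverse nf_times_1_right)
  show "(R + S) * T = R * T + S * T" "R * (S + T) = R * S + R * T"
    by (simp_all add: weyl_ops Weyl_inverse nf_times_add_left nf_times_add_right)
  show "R + S + T = R + (S + T)" "R + S = S + R" "0 + R = R" "- R + R = 0" "R - S = R + - S"
    by (simp_all add: weyl_ops Weyl_inverse weyl_nf_inverse algebra_simps)
  show "(0 :: weyl) \<noteq> 1"
    by (simp add: weyl_ops Weyl_inject)
qed

end

definition weyl_poly :: "rat poly \<Rightarrow> weyl" where
  "weyl_poly p = Weyl [:p:]"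

definition weyl_D :: weyl where
  "weyl_D = Weyl [:0, 1:]"

text \<open>\<open>weyl_coeff R j\<close> is the coefficient \<open>P\<^sub>j\<close> and \<open>weyl_order R\<close> the degree of \<open>R\<close> in \<open>\<partial>\<close>.\<close>

definition weyl_coeff :: "weyl \<Rightarrow> nat \<Rightarrow> rat poly" where
  "weyl_coeff R = coeff (weyl_nf R)"

definition weyl_order :: "weyl \<Rightarrow> nat" where
  "weyl_order R = degree (weyl_nf R)"

lemma weyl_nf_simps:
  "weyl_nf 0 = 0" "weyl_nf 1 = 1" "weyl_nf (R + S) = weyl_nf R + weyl_nf S"
  "weyl_nf (R * S) = nf_times (weyl_nf R) (weyl_nf S)"
  "weyl_nf (weyl_poly p) = [:p:]" "weyl_nf weyl_D = [:0, 1:]"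
  by (simp_all add: weyl_ops weyl_poly_def weyl_D_def Weyl_inverse)

lemma weyl_D_commute: "weyl_D * weyl_poly p = weyl_poly p * weyl_D + weyl_poly (pderiv p)"
  by (simp add: weyl_nf_simps nf_times_pCons nf_D_pCons flip: weyl_nf_inject)

lemma weyl_D_power: "weyl_nf (weyl_D ^ j) = monom 1 j"
proof (induction j)
  case (Suc j)
  thus ?case
    by (simp add: weyl_nf_simps nf_times_pCons nf_D_def map_poly_monom monom_Suc)
qed (simp add: weyl_nf_simps monom_0 one_pCons)

lemma weyl_nf_sum: "weyl_nf (\<Sum>j\<in>A. f j) = (\<Sum>j\<in>A. weyl_nf (f j))"
  by (induction A rule: infinite_finite_induct) (auto simp: weyl_nf_simps)

lemma weyl_normal_form:
  "R = (\<Sum>j\<le>weyl_order R. weyl_poly (weyl_coeff R j) * weyl_D ^ j)"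
proof -
  have "weyl_nf (\<Sum>j\<le>weyl_order R. weyl_poly (weyl_coeff R j) * weyl_D ^ j) = weyl_nf R"
    by (simp add: weyl_nf_sum weyl_nf_simps weyl_D_power weyl_coeff_def weyl_order_def
        smult_monom poly_as_sum_of_monoms)
  thus ?thesis by (simp add: weyl_nf_inject)
qed

definition weyl_act :: "weyl \<Rightarrow> rat poly \<Rightarrow> rat poly" where
  "weyl_act R p = (\<Sum>j\<le>weyl_order R. weyl_coeff R j * (pderiv ^^ j) p)"

text \<open>
  \<open>\<rat>[z, \<partial>\<^sub>z]\<close> and \<open>\<rat>[t, \<partial>\<^sub>t]\<close> are the same type here, and so are \<open>\<rat>[z]\<close> and \<open>\<rat>[t]\<close>:
  the names of the variables are not recorded.
\<close>

definition weyl_adjoint :: "weyl \<Rightarrow> weyl" where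
  "weyl_adjoint R = (\<Sum>j\<le>weyl_order R. (-1) ^ j * weyl_D ^ j * weyl_poly (weyl_coeff R j))"


section \<open>Series in \<open>1/z\<close>\<close>

text \<open>
  An element of \<open>\<rat>((1/z))\<close> is a \<^typ>\<open>rat fls\<close> and an element of \<open>\<rat>[[1/z]]\<close> is a \<^typ>\<open>rat fps\<close>,
  in both cases with the formal variable standing for \<open>1/z\<close>; thus \<^const>\<open>fls_X_inv\<close> is \<open>z\<close>.
\<close>

definition poly_at_infinity :: "rat poly \<Rightarrow> rat fls" where
  "poly_at_infinity p = (\<Sum>k\<le>degree p. fls_const (coeff p k) * fls_X_inv ^ k)"

text \<open>
  \<^const>\<open>fls_subdegree\<close> is the least index of a nonzero coefficient; only its value at \<open>0\<close> has
  to be corrected.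
\<close>

definition ord_infinity :: "rat fls \<Rightarrow> int extended" where
  "ord_infinity f = (if f = 0 then Pinf else Fin (fls_subdegree f))"

text \<open>The series of \<open>log (1 - 1/z)\<close>; the coefficient at \<open>k = 0\<close> vanishes as \<open>- 1 / 0 = 0\<close>.\<close>

definition log_series :: "rat fps" where
  "log_series = Abs_fps (\<lambda>k. - 1 / of_nat k)"


section \<open>The functionals and the approximants\<close>

text \<open>
  \<open>\<rat>[z][t]\<close> is \<^typ>\<open>rat poly poly\<close>, with \<open>z\<close> the inner and \<open>t\<close> the outer variable. For
  \<open>f = (\<Sum>k. f\<^sub>k z\<^sup>-\<^sup>k\<^sup>-\<^sup>1)\<close> the number \<open>f\<^sub>k\<close> is the coefficient of \<open>f\<close> with index \<open>k + 1\<close>.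
\<close>

definition phi :: "rat fps \<Rightarrow> rat poly poly \<Rightarrow> rat poly" where
  "phi f F = (\<Sum>k\<le>degree F. smult (fps_nth f (Suc k)) (coeff F k))"

text \<open>
  \<open>(P(z) - P(t)) / (z - t)\<close> in \<open>\<rat>[z][t]\<close>; the lemma shows that the division is exact.
\<close>

definition in_z :: "rat poly \<Rightarrow> rat poly poly" where
  "in_z p = [:p:]"

definition in_t :: "rat poly \<Rightarrow> rat poly poly" where
  "in_t p = map_poly (\<lambda>c. [:c:]) p"

definition difference_quotient :: "rat poly \<Rightarrow> rat poly poly" where
  "difference_quotient p = (in_z p - in_t p) div (in_z [:0, 1:] - in_t [:0, 1:])"

lemma difference_quotient_mult:
  "difference_quotient p * (in_z [:0, 1:] - in_t [:0, 1:]) = in_z p - in_t p"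
proof -
  let ?d = "in_z [:0, 1:] - in_t [:0, 1:]"
  have d: "?d = - [:- [:0, 1:], 1:]"
    by (simp add: in_z_def in_t_def map_poly_pCons one_pCons)
  have "poly (in_t p) [:0, 1:] = p"
    by (induction p) (simp_all add: in_t_def map_poly_pCons)
  hence "poly (in_z p - in_t p) [:0, 1:] = 0"
    by (simp add: in_z_def)
  hence "?d dvd in_z p - in_t p"
    unfolding d by (simp only: minus_dvd_iff poly_eq_0_iff_dvd)
  thus ?thesis
    by (simp add: difference_quotient_def)
qed

definition R_op :: "nat \<Rightarrow> nat \<Rightarrow> weyl" where
  "R_op m n = weyl_poly [:1 / fact n ^ m:] *
     (weyl_poly ([:0, 1:] ^ n * [:-1, 1:] ^ n) * weyl_D ^ n) ^ m"

definition P_pade :: "nat \<Rightarrow> nat \<Rightarrow> nat \<Rightarrow> rat poly" where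
  "P_pade m n l = weyl_act (weyl_adjoint (R_op m n)) (monom 1 l)"

definition Q_pade :: "nat \<Rightarrow> nat \<Rightarrow> nat \<Rightarrow> nat \<Rightarrow> rat poly" where
  "Q_pade m n s l = phi (log_series ^ s) (difference_quotient (P_pade m n l))"

text \<open>The tuples \<open>(f\<^sub>1, \<dots>, f\<^sub>m)\<close> and \<open>(Q\<^sub>1, \<dots>, Q\<^sub>m)\<close> are functions read on \<open>{1..m}\<close> only.\<close>

definition pade_type_approximant ::
    "nat \<Rightarrow> nat \<Rightarrow> (nat \<Rightarrow> rat fps) \<Rightarrow> rat poly \<Rightarrow> (nat \<Rightarrow> rat poly) \<Rightarrow> bool" where
  "pade_type_approximant m n f P Q \<longleftrightarrow>
     (\<exists>D::int. D \<ge> int m * int n \<and> int (degree P) \<le> D \<and>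
        (\<forall>j\<in>{1..m}. ord_infinity
           (poly_at_infinity P * fps_to_fls (f j) - poly_at_infinity (Q j)) \<ge> Fin (int n + 1)))"

end

theory Submission
  imports Defs
begin

text \<open>
  Write \<open>L = log (1 - 1/z)\<close>, \<open>w = z (z - 1)\<close> and \<open>T = w\<^sup>n \<partial>\<^sup>n\<close>, so that \<open>R\<^sub>n\<close> is \<open>T\<^sup>m\<close> up to a constant,
  and let \<open>Res\<close> be the coefficient of \<open>1/z\<close> of a Laurent series in \<open>1/z\<close>.

  Since \<open>\<phi>\<^sub>s(p) = Res (p L\<^sup>s)\<close>, the polynomial \<open>Q\<^sub>s\<close> is exactly the polynomial part of \<open>P L\<^sup>s\<close>
  (\<open>phi_difference_quotient\<close>). The order condition therefore says that
  \<open>Res (z\<^sup>k P L\<^sup>s) = 0\<close> for \<open>k < n\<close> and \<open>1 \<le> s \<le> m\<close>. A derivative has residue \<open>0\<close>, so integration by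
  parts (\<open>residue_weyl_adjoint\<close>) moves \<open>R\<^sub>n\<^sup>*\<close> from \<open>z\<^sup>l\<close> to the other factor:
  \<open>Res (z\<^sup>k (R\<^sub>n\<^sup>* z\<^sup>l) L\<^sup>s) = Res (z\<^sup>l R\<^sub>n (z\<^sup>k L\<^sup>s))\<close>. It remains to see that \<open>R\<^sub>n (z\<^sup>k L\<^sup>s)\<close> is a
  polynomial, because polynomials have residue \<open>0\<close>.

  For this let \<open>V\<^sub>s\<close> consist of the sums of \<open>p\<^sub>i L\<^sup>i\<close> over \<open>i < s\<close> with all \<open>deg p\<^sub>i < n\<close>. Then \<open>z\<^sup>k L\<^sup>s\<close>
  lies in \<open>V\<^sub>m\<^sub>+\<^sub>1\<close> and \<open>V\<^sub>1\<close> consists of polynomials, so it suffices that \<open>T\<close> maps \<open>V\<^sub>s\<^sub>+\<^sub>1\<close> into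
  \<open>V\<^sub>s\<close> (\<open>T_log_filtration\<close>). Because \<open>w L' = 1\<close>, the operator \<open>T\<close> lifts to an operator on \<open>\<rat>[z][X]\<close>,
  where \<open>X\<close> stands for \<open>L\<close>, and the lift commutes with \<open>d/dX\<close>: the derivative of \<open>L\<close> does not change
  when a constant is added to \<open>L\<close>. Two facts follow.

  \<^item> The degree in \<open>X\<close> drops. Applying \<open>d/dX\<close> \<open>s\<close> times to an element of \<open>V\<^sub>s\<^sub>+\<^sub>1\<close> leaves a
    polynomial in \<open>z\<close> of degree less than \<open>n\<close>, and \<open>\<partial>\<^sup>n\<close> kills it.

  \<^item> The coefficients keep degree less than \<open>n\<close>. A series \<open>f = O(z\<^sup>n\<^sup>-\<^sup>1)\<close> satisfies
    \<open>\<partial>\<^sup>n f = O(z\<^sup>-\<^sup>n\<^sup>-\<^sup>1)\<close>, because the monomials \<open>1, \<dots>, z\<^sup>n\<^sup>-\<^sup>1\<close> are killed; hence \<open>T f = O(z\<^sup>n\<^sup>-\<^sup>1)\<close>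
    again. This applies to all \<open>X\<close>-derivatives, and as \<open>L = O(1/z)\<close> the bound passes from these
    values to the coefficients (\<open>ord_coeff_from_eval_log\<close>).
\<close>

unbundle fps_syntax

section \<open>Polynomials as Laurent series at infinity\<close>

lemma poly_at_infinity_nth:
  "poly_at_infinity p $$ i = (if i \<le> 0 then coeff p (nat (- i)) else 0)"
proof -
  have "poly_at_infinity p $$ i = (\<Sum>k\<le>degree p. if i = - int k then coeff p k else 0)"
    unfolding poly_at_infinity_def fls_nth_sum by (intro sum.cong) auto
  also have "\<dots> = (if i \<le> 0 then coeff p (nat (- i)) else 0)"
  proof (cases "i \<le> 0")
    case True
    hence "(\<Sum>k\<le>degree p. if i = - int k then coeff p k else 0) =
        (\<Sum>k\<le>degree p. if nat (- i) = k then coeff p k else 0)"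
      by (intro sum.cong) auto
    thus ?thesis
      using True by (simp add: coeff_eq_0)
  qed (auto intro!: sum.neutral)
  finally show ?thesis .
qed

lemma poly_at_infinity_0 [simp]: "poly_at_infinity 0 = 0"
  by (intro fls_eqI) (simp add: poly_at_infinity_nth)

lemma poly_at_infinity_const: "poly_at_infinity [:c:] = fls_const c"
  by (intro fls_eqI) (auto simp: poly_at_infinity_nth coeff_pCons split: nat.splits)

lemma poly_at_infinity_1 [simp]: "poly_at_infinity 1 = 1"
  using poly_at_infinity_const[of 1] by (simp add: pCons_one)

lemma poly_at_infinity_add: "poly_at_infinity (p + q) = poly_at_infinity p + poly_at_infinity q"
  by (intro fls_eqI) (simp add: poly_at_infinity_nth)

lemma poly_at_infinity_sum: "poly_at_infinity (\<Sum>x\<in>A. p x) = (\<Sum>x\<in>A. poly_at_infinity (p x))"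
  by (induction A rule: infinite_finite_induct) (simp_all add: poly_at_infinity_add)

lemma poly_at_infinity_smult: "poly_at_infinity (smult c p) = fls_const c * poly_at_infinity p"
  by (intro fls_eqI) (simp add: poly_at_infinity_nth)

lemma poly_at_infinity_pCons:
  "poly_at_infinity (pCons a p) = fls_const a + fls_X_inv * poly_at_infinity p"
proof (intro fls_eqI)
  fix i
  consider "i = 0" | "i > 0" | j where "i = - int (Suc j)"
    using negD[of i] by fastforce
  thus "poly_at_infinity (pCons a p) $$ i = (fls_const a + fls_X_inv * poly_at_infinity p) $$ i"
  proof cases
    case 3
    hence "nat (- i) = Suc j" "nat (- i - 1) = j" by auto
    thus ?thesis using 3 by (simp add: poly_at_infinity_nth fls_X_inv_times_conv_shift)
  qed (simp_all add: poly_at_infinity_nth fls_X_inv_times_conv_shift)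
qed

lemma poly_at_infinity_mult: "poly_at_infinity (p * q) = poly_at_infinity p * poly_at_infinity q"
  by (induction p)
     (simp_all add: poly_at_infinity_pCons poly_at_infinity_add poly_at_infinity_smult algebra_simps)

lemma poly_at_infinity_power: "poly_at_infinity (p ^ k) = poly_at_infinity p ^ k"
  by (induction k) (simp_all add: poly_at_infinity_mult)

lemma ord_infinity_ge_iff: "Fin a \<le> ord_infinity f \<longleftrightarrow> (\<forall>i<a. f $$ i = 0)"
proof (cases "f = 0")
  case False
  show ?thesis
    using False fls_subdegree_geI[of f a] by (auto simp: ord_infinity_def)
qed (simp add: ord_infinity_def)

lemma ord_infinity_ge_add:
  "Fin a \<le> ord_infinity f \<Longrightarrow> Fin a \<le> ord_infinity g \<Longrightarrow> Fin a \<le> ord_infinity (f + g)"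
  by (simp add: ord_infinity_ge_iff)

lemma ord_infinity_ge_diff:
  "Fin a \<le> ord_infinity f \<Longrightarrow> Fin a \<le> ord_infinity g \<Longrightarrow> Fin a \<le> ord_infinity (f - g)"
  by (simp add: ord_infinity_ge_iff)

lemma ord_infinity_ge_mult:
  assumes "Fin a \<le> ord_infinity f" "Fin b \<le> ord_infinity g"
  shows "Fin (a + b) \<le> ord_infinity (f * g)"
proof (cases "f = 0 \<or> g = 0")
  case False
  thus ?thesis using assms by (simp add: ord_infinity_def)
qed (auto simp: ord_infinity_def)

section \<open>Differentiation at infinity\<close>

definition deriv_z :: "rat fls \<Rightarrow> rat fls" where
  "deriv_z f = - (fls_X ^ 2 * fls_deriv f)"

lemma deriv_z_nth: "deriv_z f $$ i = of_int (1 - i) * f $$ (i - 1)"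
  by (simp add: deriv_z_def fls_X_power_times_conv_shift(1)) (simp add: algebra_simps)

lemma deriv_z_add: "deriv_z (f + g) = deriv_z f + deriv_z g"
  by (intro fls_eqI) (simp add: deriv_z_nth algebra_simps)

lemma deriv_z_0 [simp]: "deriv_z 0 = 0"
  by (intro fls_eqI) (simp add: deriv_z_nth)

lemma deriv_z_mult: "deriv_z (f * g) = deriv_z f * g + f * deriv_z g"
  by (simp add: deriv_z_def algebra_simps)

lemma deriv_z_poly: "deriv_z (poly_at_infinity p) = poly_at_infinity (pderiv p)"
proof (intro fls_eqI)
  fix i
  show "deriv_z (poly_at_infinity p) $$ i = poly_at_infinity (pderiv p) $$ i"
  proof (cases "i \<le> 0")
    case True
    then obtain j where "i = - int j" by (rule nonpos_int_cases)
    moreover have "nat (1 + int j) = Suc j" by simp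
    ultimately show ?thesis by (simp add: deriv_z_nth poly_at_infinity_nth coeff_pderiv)
  qed (auto simp: deriv_z_nth poly_at_infinity_nth)
qed

lemma higher_deriv_z_poly:
  "(deriv_z ^^ j) (poly_at_infinity p) = poly_at_infinity ((pderiv ^^ j) p)"
  by (induction j) (simp_all add: deriv_z_poly)

text \<open>
  In \<open>f\<close> only \<open>z\<^sup>n\<^sup>-\<^sup>1\<close> and lower powers occur. Those with exponents \<open>0, \<dots>, n - 1\<close> are killed by the
  \<open>n\<close>-th derivative, and every negative exponent drops by \<open>n\<close>. This gain of \<open>n\<close> over the obvious bound
  is where the order of the approximation comes from.
\<close>

lemma higher_deriv_z_ord:
  assumes "Fin (1 - int n) \<le> ord_infinity f"
  shows "Fin (int n + 1) \<le> ord_infinity ((deriv_z ^^ n) f)"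
proof -
  \<comment> \<open>Indices are exponents of \<open>1/z\<close>. A gap at \<open>1, \<dots>, j\<close> opens up since the constant term
    differentiates to \<open>0\<close>.\<close>
  have vanish: "(deriv_z ^^ j) f $$ i = 0" if "i \<le> int j - int n \<or> (1 \<le> i \<and> i \<le> int j)" for i j
    using that
  proof (induction j arbitrary: i)
    case 0
    thus ?case using assms by (auto simp: ord_infinity_ge_iff)
  next
    case (Suc j)
    have "i = 1 \<or> (deriv_z ^^ j) f $$ (i - 1) = 0"
      using Suc.prems Suc.IH[of "i - 1"] by force
    thus ?case by (auto simp: deriv_z_nth)
  qed
  show ?thesis
    unfolding ord_infinity_ge_iff by (intro allI impI vanish) auto
qed

section \<open>The action of the Weyl algebra and the adjoint\<close>

text \<open>
  The action is set up on all of \<open>\<rat>((1/z))\<close>, which contains both the polynomials, on which the adjoint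
  acts, and the powers of \<open>L\<close>, on which \<open>R\<^sub>n\<close> acts. As in the definition of the product, it is
  given first on normal forms.
\<close>

definition nf_act :: "rat poly poly \<Rightarrow> rat fls \<Rightarrow> rat fls" where
  "nf_act A f = (\<Sum>j\<le>degree A. poly_at_infinity (coeff A j) * (deriv_z ^^ j) f)"

lemma nf_act_0 [simp]: "nf_act 0 f = 0"
  by (simp add: nf_act_def)

lemma nf_act_pCons: "nf_act (pCons a A) f = poly_at_infinity a * f + nf_act A (deriv_z f)"
proof (cases "A = 0")
  case False
  thus ?thesis
    by (simp add: nf_act_def sum.atMost_Suc_shift funpow_Suc_right
        del: sum.atMost_Suc funpow.simps)
qed (simp add: nf_act_def)

lemma nf_act_add: "nf_act (A + B) f = nf_act A f + nf_act B f"
  by (induction A B arbitrary: f rule: poly_induct2)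
     (auto simp: nf_act_pCons poly_at_infinity_add algebra_simps)

lemma nf_act_smult: "nf_act (smult a A) f = poly_at_infinity a * nf_act A f"
  by (induction A arbitrary: f) (auto simp: nf_act_pCons poly_at_infinity_mult algebra_simps)

lemma nf_act_nf_D: "nf_act (nf_D A) f = deriv_z (nf_act A f)"
  by (induction A arbitrary: f)
     (auto simp: nf_D_pCons nf_act_pCons nf_act_add deriv_z_add deriv_z_mult deriv_z_poly
        algebra_simps)

lemma nf_act_times_left: "nf_act (nf_times A B) f = nf_act A (nf_act B f)"
  by (induction A arbitrary: B)
     (auto simp: nf_times_pCons nf_act_pCons nf_act_add nf_act_smult nf_act_nf_D)

definition weyl_act_fls :: "weyl \<Rightarrow> rat fls \<Rightarrow> rat fls" where
  "weyl_act_fls R = nf_act (weyl_nf R)"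

lemma weyl_act_fls_0 [simp]: "weyl_act_fls 0 f = 0"
  by (simp add: weyl_act_fls_def weyl_nf_simps)

lemma weyl_act_fls_1 [simp]: "weyl_act_fls 1 f = f"
  using nf_act_pCons[of 1 0 f] by (simp add: weyl_act_fls_def weyl_nf_simps pCons_one)

lemma weyl_act_fls_add: "weyl_act_fls (R + S) f = weyl_act_fls R f + weyl_act_fls S f"
  by (simp add: weyl_act_fls_def weyl_nf_simps nf_act_add)

lemma weyl_act_fls_uminus: "weyl_act_fls (- R) f = - weyl_act_fls R f"
  using weyl_act_fls_add[of R "- R" f] by (simp add: minus_unique)

lemma weyl_act_fls_sum: "weyl_act_fls (\<Sum>x\<in>A. R x) f = (\<Sum>x\<in>A. weyl_act_fls (R x) f)"
  by (induction A rule: infinite_finite_induct) (simp_all add: weyl_act_fls_add)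

lemma weyl_act_fls_mult: "weyl_act_fls (R * S) f = weyl_act_fls R (weyl_act_fls S f)"
  by (simp add: weyl_act_fls_def weyl_nf_simps nf_act_times_left)

lemma weyl_act_fls_power: "weyl_act_fls (R ^ k) f = (weyl_act_fls R ^^ k) f"
  by (induction k) (simp_all add: weyl_act_fls_mult)

lemma weyl_act_fls_poly: "weyl_act_fls (weyl_poly p) f = poly_at_infinity p * f"
  by (simp add: weyl_act_fls_def weyl_nf_simps nf_act_pCons)

lemma weyl_act_fls_D: "weyl_act_fls weyl_D f = deriv_z f"
  by (simp add: weyl_act_fls_def weyl_nf_simps nf_act_pCons)

lemma weyl_act_fls_D_power: "weyl_act_fls (weyl_D ^ j) f = (deriv_z ^^ j) f"
proof -
  have "weyl_act_fls weyl_D = deriv_z"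
    by (simp add: fun_eq_iff weyl_act_fls_D)
  thus ?thesis by (simp add: weyl_act_fls_power)
qed

lemma weyl_act_fls_minus_one_power:
  "weyl_act_fls ((- 1) ^ j) f = (- 1) ^ j * f"
  by (cases "even j") (simp_all add: weyl_act_fls_uminus)

lemma poly_at_infinity_weyl_act:
  "poly_at_infinity (weyl_act R p) = weyl_act_fls R (poly_at_infinity p)"
  by (simp add: weyl_act_def weyl_act_fls_def nf_act_def weyl_order_def weyl_coeff_def
      poly_at_infinity_sum poly_at_infinity_mult higher_deriv_z_poly)

lemma residue_deriv_z: "deriv_z f $$ 1 = 0"
  by (simp add: deriv_z_nth)

lemma residue_by_parts:
  "((deriv_z ^^ j) f * g) $$ 1 = (- 1) ^ j * (f * (deriv_z ^^ j) g) $$ 1"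
proof (induction j arbitrary: g)
  case (Suc j)
  let ?h = "(deriv_z ^^ j) f"
  have "(deriv_z ?h * g) $$ 1 = - (?h * deriv_z g) $$ 1"
    using residue_deriv_z[of "?h * g"] by (simp add: deriv_z_mult eq_neg_iff_add_eq_0)
  also have "\<dots> = - ((- 1) ^ j * (f * (deriv_z ^^ j) (deriv_z g)) $$ 1)"
    by (simp add: Suc.IH)
  finally show ?case by (simp add: funpow_swap1)
qed simp

text \<open>
  Multiplication by a polynomial is self-adjoint for the pairing \<open>Res (f g)\<close>, and \<open>\<partial>\<close> has the adjoint
  \<open>- \<partial>\<close>; the formal adjoint reverses the order of the factors of each term.
\<close>

lemma residue_weyl_adjoint:
  "(weyl_act_fls (weyl_adjoint R) f * g) $$ 1 = (f * weyl_act_fls R g) $$ 1"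
proof -
  have "(weyl_act_fls (weyl_adjoint R) f * g) $$ 1 =
      (\<Sum>j\<le>weyl_order R.
        ((- 1) ^ j * ((deriv_z ^^ j) (poly_at_infinity (weyl_coeff R j) * f) * g)) $$ 1)"
    by (simp add: weyl_adjoint_def weyl_act_fls_sum weyl_act_fls_mult weyl_act_fls_D_power
        weyl_act_fls_minus_one_power weyl_act_fls_poly sum_distrib_right fls_nth_sum mult.assoc)
  also have "\<dots> =
      (\<Sum>j\<le>weyl_order R. (f * (poly_at_infinity (weyl_coeff R j) * (deriv_z ^^ j) g)) $$ 1)"
  proof (intro sum.cong refl)
    fix j
    have pull_sign: "((- 1) ^ j * h) $$ 1 = (- 1) ^ j * h $$ 1" for h :: "rat fls"
      by (cases "even j") simp_all
    show "((- 1) ^ j * ((deriv_z ^^ j) (poly_at_infinity (weyl_coeff R j) * f) * g)) $$ 1 =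
        (f * (poly_at_infinity (weyl_coeff R j) * (deriv_z ^^ j) g)) $$ 1"
      by (simp only: pull_sign residue_by_parts left_minus_one_mult_self) (simp add: mult_ac)
  qed
  also have "\<dots> = (f * weyl_act_fls R g) $$ 1"
    by (simp add: weyl_act_fls_def nf_act_def weyl_order_def weyl_coeff_def sum_distrib_left
        fls_nth_sum)
  finally show ?thesis .
qed

section \<open>Polynomials in the logarithm\<close>

abbreviation log_infinity :: "rat fls" where
  "log_infinity \<equiv> fps_to_fls log_series"

definition w_poly :: "rat poly" where
  "w_poly = [:0, 1:] * [:- 1, 1:]"

lemma w_deriv_log: "poly_at_infinity w_poly * deriv_z log_infinity = 1"
proof (intro fls_eqI)
  fix i
  have d: "deriv_z log_infinity $$ k = (if k \<ge> 2 then 1 else 0)" for k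
    by (auto simp: deriv_z_nth log_series_def field_simps)
  have "fls_const (- 1) = (- 1 :: rat fls)"
    by (intro fls_eqI) simp
  hence "poly_at_infinity w_poly = fls_X_inv ^ 2 - fls_X_inv"
    by (simp add: w_poly_def poly_at_infinity_pCons poly_at_infinity_const power2_eq_square
        algebra_simps)
  thus "(poly_at_infinity w_poly * deriv_z log_infinity) $$ i = 1 $$ i"
    by (simp add: left_diff_distrib fls_X_inv_power_times_conv_shift fls_X_inv_times_conv_shift d)
qed

definition eval_log :: "rat poly poly \<Rightarrow> rat fls" where
  "eval_log F = poly (map_poly poly_at_infinity F) log_infinity"

lemma eval_log_0 [simp]: "eval_log 0 = 0"
  by (simp add: eval_log_def)

lemma eval_log_pCons: "eval_log (pCons p F) = poly_at_infinity p + log_infinity * eval_log F"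
  by (simp add: eval_log_def map_poly_pCons)

lemma eval_log_add: "eval_log (F + G) = eval_log F + eval_log G"
  by (induction F G rule: poly_induct2)
     (simp_all add: eval_log_pCons poly_at_infinity_add algebra_simps)

lemma eval_log_smult: "eval_log (smult p F) = poly_at_infinity p * eval_log F"
  by (induction F) (simp_all add: eval_log_pCons poly_at_infinity_mult algebra_simps)

lemma eval_log_diff: "eval_log (F - G) = eval_log F - eval_log G"
  using eval_log_add[of "F - G" G] by simp

lemma eval_log_monom: "eval_log (monom p s) = poly_at_infinity p * log_infinity ^ s"
  by (induction s) (simp_all add: monom_0 monom_Suc eval_log_pCons)

text \<open>
  The lift of the derivation \<open>w \<partial>\<close> from \<open>\<rat>((1/z))\<close> to \<open>\<rat>[z][X]\<close>, with \<open>X\<close> the outer variable. The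
  summand \<open>d/dX\<close> is there because \<open>w \<partial> L = 1\<close>; thanks to the factor \<open>w\<close> no denominators appear.
\<close>

definition w_deriv :: "rat poly poly \<Rightarrow> rat poly poly" where
  "w_deriv F = smult w_poly (map_poly pderiv F) + pderiv F"

lemma w_deriv_pCons: "w_deriv (pCons p F) = pCons (w_poly * pderiv p) (w_deriv F) + F"
  by (simp add: w_deriv_def map_poly_pCons pderiv_pCons)

lemma eval_log_w_deriv: "eval_log (w_deriv F) = poly_at_infinity w_poly * deriv_z (eval_log F)"
proof (induction F)
  case (pCons p F)
  have "poly_at_infinity w_poly * deriv_z (eval_log (pCons p F)) =
      poly_at_infinity (w_poly * pderiv p) +
      (poly_at_infinity w_poly * deriv_z log_infinity) * eval_log F +
      log_infinity * (poly_at_infinity w_poly * deriv_z (eval_log F))"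
    by (simp only: eval_log_pCons deriv_z_add deriv_z_mult deriv_z_poly poly_at_infinity_mult)
       (simp add: algebra_simps)
  thus ?case
    by (simp only: w_deriv_log pCons.IH[symmetric] w_deriv_pCons eval_log_add eval_log_pCons) simp
qed (simp add: w_deriv_def)

lemma pderiv_w_deriv: "pderiv (w_deriv F) = w_deriv (pderiv F)"
  by (rule poly_eqI)
     (simp add: w_deriv_def coeff_pderiv coeff_map_poly pderiv_mult algebra_simps
        pderiv_add pderiv_of_nat)

lemma mult_pderiv_power:
  "p * pderiv (p ^ j) = of_nat j * pderiv p * (p :: rat poly) ^ j"
proof (induction j)
  case (Suc j)
  have "p * pderiv (p ^ Suc j) = p * (p * pderiv (p ^ j)) + pderiv p * p ^ Suc j"
    by (simp add: pderiv_mult algebra_simps)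
  also have "\<dots> = of_nat (Suc j) * pderiv p * p ^ Suc j"
    by (simp only: Suc.IH) (simp add: algebra_simps)
  finally show ?case .
qed simp

text \<open>
  The lift of \<open>w\<^sup>j \<partial>\<^sup>j\<close>. If \<open>g = w\<^sup>j \<partial>\<^sup>j f\<close>, then \<open>w\<^sup>j\<^sup>+\<^sup>1 \<partial>\<^sup>j\<^sup>+\<^sup>1 f = w\<^sup>j\<^sup>+\<^sup>1 \<partial> (w\<^sup>-\<^sup>j g) = w \<partial> g - j w' g\<close>,
  which is the recursion below.
\<close>

fun T_log :: "nat \<Rightarrow> rat poly poly \<Rightarrow> rat poly poly" where
  "T_log 0 F = F"
| "T_log (Suc j) F = w_deriv (T_log j F) - smult (of_nat j * pderiv w_poly) (T_log j F)"

lemma eval_T_log: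
  "eval_log (T_log j F) = poly_at_infinity w_poly ^ j * (deriv_z ^^ j) (eval_log F)"
proof (induction j)
  case (Suc j)
  let ?w = "poly_at_infinity w_poly" and ?g = "(deriv_z ^^ j) (eval_log F)"
  have "?w * deriv_z (?w ^ j) = poly_at_infinity (of_nat j * pderiv w_poly) * ?w ^ j"
    using mult_pderiv_power[of w_poly j]
    by (metis deriv_z_poly poly_at_infinity_mult poly_at_infinity_power)
  hence "?w * (deriv_z (?w ^ j) * ?g) =
      poly_at_infinity (of_nat j * pderiv w_poly) * (?w ^ j * ?g)"
    by (simp flip: mult.assoc)
  thus ?case
    by (simp add: eval_log_diff eval_log_w_deriv eval_log_smult Suc.IH deriv_z_mult distrib_left
        mult.assoc)
qed simp

lemma pderiv_T_log: "pderiv (T_log j F) = T_log j (pderiv F)"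
  by (induction j) (simp_all add: pderiv_diff pderiv_smult pderiv_w_deriv)

lemma higher_pderiv_T_log: "(pderiv ^^ i) (T_log j F) = T_log j ((pderiv ^^ i) F)"
  by (induction i) (simp_all add: pderiv_T_log)

lemma T_log_const: "T_log j [:p:] = [:w_poly ^ j * (pderiv ^^ j) p:]"
proof (induction j)
  case (Suc j)
  have "w_poly * pderiv (w_poly ^ j * q) - of_nat j * pderiv w_poly * (w_poly ^ j * q)
      = w_poly ^ Suc j * pderiv q" for q
    using arg_cong[OF mult_pderiv_power[of w_poly j], of "\<lambda>x. x * q"]
    by (simp add: pderiv_mult algebra_simps)
  thus ?case
    by (simp add: Suc.IH w_deriv_def map_poly_pCons)
qed simp

section \<open>Degrees of the coefficients\<close>

lemma ord_log_infinity: "Fin 0 \<le> ord_infinity log_infinity"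
  by (simp add: ord_infinity_ge_iff)

lemma eval_log_ord:
  assumes "\<And>i. Fin a \<le> ord_infinity (poly_at_infinity (coeff F i))"
  shows "Fin a \<le> ord_infinity (eval_log F)"
  using assms
proof (induction F)
  case (pCons p F)
  have "Fin a \<le> ord_infinity (poly_at_infinity p)"
    using pCons.prems[of 0] by simp
  moreover have "Fin a \<le> ord_infinity (eval_log F)"
    using pCons.prems[of "Suc i" for i] by (intro pCons.IH) simp
  ultimately show ?case
    using ord_infinity_ge_mult[OF ord_log_infinity, of a "eval_log F"]
    by (simp add: eval_log_pCons ord_infinity_ge_add)
qed (simp add: ord_infinity_def)

lemma ord_coeff_pderiv:
  "Fin a \<le> ord_infinity (poly_at_infinity (coeff (pderiv F) i)) \<longleftrightarrow>
   Fin a \<le> ord_infinity (poly_at_infinity (coeff F (Suc i)))"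
  by (simp add: ord_infinity_ge_iff poly_at_infinity_nth coeff_pderiv of_nat_poly
      del: of_nat_Suc)

text \<open>
  The converse of \<open>eval_log_ord\<close> fails for a single value, since the terms of \<open>\<Sum>\<^sub>i p\<^sub>i L\<^sup>i\<close> may cancel at
  infinity. With the \<open>X\<close>-derivatives also bounded it holds by induction on the degree: the derivative
  controls all coefficients but the constant one, and that one is what remains of \<open>F(L)\<close> when the
  other terms are subtracted.
\<close>

lemma ord_coeff_from_eval_log:
  assumes "\<And>i. Fin a \<le> ord_infinity (eval_log ((pderiv ^^ i) F))"
  shows "Fin a \<le> ord_infinity (poly_at_infinity (coeff F i))"
  using assms
proof (induction "degree F" arbitrary: F i rule: less_induct)
  case less
  obtain p G where F: "F = pCons p G" by (cases F)
  have higher: "Fin a \<le> ord_infinity (poly_at_infinity (coeff F (Suc j)))" for j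
  proof (cases "degree F = 0")
    case True
    thus ?thesis by (simp add: coeff_eq_0 ord_infinity_def)
  next
    case False
    have "Fin a \<le> ord_infinity (eval_log ((pderiv ^^ i) (pderiv F)))" for i
      using less.prems[of "Suc i"] by (simp add: funpow_swap1)
    hence "Fin a \<le> ord_infinity (poly_at_infinity (coeff (pderiv F) j))"
      using False by (intro less.hyps) (simp_all add: degree_pderiv)
    thus ?thesis by (simp only: ord_coeff_pderiv)
  qed
  hence "Fin a \<le> ord_infinity (eval_log G)"
    by (intro eval_log_ord) (simp add: F)
  hence "Fin a \<le> ord_infinity (log_infinity * eval_log G)"
    using ord_infinity_ge_mult[OF ord_log_infinity] by fastforce
  moreover have "Fin a \<le> ord_infinity (eval_log F)"
    using less.prems[of 0] by simp
  moreover have "poly_at_infinity (coeff F 0) = eval_log F - log_infinity * eval_log G"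
    by (simp add: F eval_log_pCons)
  ultimately have "Fin a \<le> ord_infinity (poly_at_infinity (coeff F 0))"
    by (simp add: ord_infinity_ge_diff)
  with higher show ?case by (cases i) auto
qed

text \<open>
  The space \<open>V\<^sub>s\<close>. Degree less than \<open>s\<close> in \<open>X\<close> is expressed through \<open>d/dX\<close>, which commutes with the lifted
  operators, and degree less than \<open>n\<close> in \<open>z\<close> through the order at infinity, which also covers the zero
  polynomial and the case \<open>n = 0\<close>.
\<close>

definition log_filtration :: "nat \<Rightarrow> nat \<Rightarrow> rat poly poly set" where
  "log_filtration n s = {F. (pderiv ^^ s) F = 0 \<and>
     (\<forall>i. Fin (1 - int n) \<le> ord_infinity (poly_at_infinity (coeff F i)))}"

text \<open>
  The \<open>n\<close>-th derivative is a polynomial of order at least \<open>n + 1 > 0\<close> at infinity, and a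
  nonzero polynomial never has positive order there.
\<close>

lemma higher_pderiv_eq_0:
  assumes "Fin (1 - int n) \<le> ord_infinity (poly_at_infinity p)"
  shows "(pderiv ^^ n) p = 0"
proof (rule poly_eqI)
  fix k
  have "poly_at_infinity ((pderiv ^^ n) p) $$ (- int k) = 0"
    using higher_deriv_z_ord[OF assms] by (simp add: higher_deriv_z_poly ord_infinity_ge_iff)
  thus "coeff ((pderiv ^^ n) p) k = coeff 0 k"
    by (simp add: poly_at_infinity_nth)
qed

text \<open>
  The \<open>s\<close>-th \<open>X\<close>-derivative of \<open>F\<close> is free of \<open>X\<close> and of degree less than \<open>n\<close>, hence killed, so the image
  has lost one power of \<open>X\<close>. On values the operator is \<open>w\<^sup>n \<partial>\<^sup>n\<close>: from order \<open>1 - n\<close> the derivative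
  leads to order \<open>n + 1\<close>, and \<open>w\<^sup>n\<close>, of degree \<open>2 n\<close>, leads back to \<open>1 - n\<close>.
\<close>

lemma T_log_filtration:
  assumes "F \<in> log_filtration n (Suc s)"
  shows "T_log n F \<in> log_filtration n s"
proof -
  have coeffs: "Fin (1 - int n) \<le> ord_infinity (poly_at_infinity (coeff ((pderiv ^^ j) F) i))"
    for i j
    using assms by (induction j arbitrary: i) (simp_all add: log_filtration_def ord_coeff_pderiv)
  have "pderiv ((pderiv ^^ s) F) = 0"
    using assms by (simp add: log_filtration_def)
  then obtain p where p: "(pderiv ^^ s) F = [:p:]"
    by (auto simp: pderiv_eq_0_iff elim: degree_eq_zeroE)
  hence "(pderiv ^^ n) p = 0"
    using coeffs[of s 0] by (intro higher_pderiv_eq_0) simp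
  hence "(pderiv ^^ s) (T_log n F) = 0"
    by (simp add: higher_pderiv_T_log p T_log_const)
  moreover have "Fin (1 - int n) \<le> ord_infinity (poly_at_infinity (coeff (T_log n F) i))" for i
  proof (rule ord_coeff_from_eval_log)
    fix j
    let ?f = "eval_log ((pderiv ^^ j) F)"
    have "Fin (- 2 * int n) \<le> ord_infinity (poly_at_infinity (w_poly ^ n))"
    proof -
      have "degree (w_poly ^ n) = 2 * n"
        by (simp add: w_poly_def degree_power_eq)
      thus ?thesis
        by (auto simp: ord_infinity_ge_iff poly_at_infinity_nth coeff_eq_0)
    qed
    moreover have "Fin (int n + 1) \<le> ord_infinity ((deriv_z ^^ n) ?f)"
      by (intro higher_deriv_z_ord eval_log_ord coeffs)
    ultimately have "Fin (- 2 * int n + (int n + 1)) \<le>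
        ord_infinity (poly_at_infinity (w_poly ^ n) * (deriv_z ^^ n) ?f)"
      by (rule ord_infinity_ge_mult)
    thus "Fin (1 - int n) \<le> ord_infinity (eval_log ((pderiv ^^ j) (T_log n F)))"
      by (simp add: higher_pderiv_T_log eval_T_log poly_at_infinity_power algebra_simps)
  qed
  ultimately show ?thesis by (simp add: log_filtration_def)
qed

lemma T_log_power_filtration:
  "F \<in> log_filtration n (m + s) \<Longrightarrow> (T_log n ^^ m) F \<in> log_filtration n s"
proof (induction m arbitrary: s)
  case (Suc m)
  thus ?case using T_log_filtration Suc.IH[of "Suc s"] by simp
qed simp

lemma R_op_eval_log:
  "weyl_act_fls (R_op m n) (eval_log F) = fls_const (1 / fact n ^ m) * eval_log ((T_log n ^^ m) F)"
proof -
  have "weyl_act_fls (weyl_poly ([:0, 1:] ^ n * [:- 1, 1:] ^ n) * weyl_D ^ n) (eval_log G) =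
      eval_log (T_log n G)" for G
    by (simp only: weyl_act_fls_mult weyl_act_fls_poly weyl_act_fls_D_power eval_T_log
        w_poly_def poly_at_infinity_power flip: power_mult_distrib)
  hence "weyl_act_fls ((weyl_poly ([:0, 1:] ^ n * [:- 1, 1:] ^ n) * weyl_D ^ n) ^ m) (eval_log F) =
      eval_log ((T_log n ^^ m) F)"
    unfolding weyl_act_fls_power by (induction m) simp_all
  thus ?thesis
    unfolding R_op_def
    by (simp add: weyl_act_fls_mult[of "weyl_poly [:_:]"] weyl_act_fls_poly poly_at_infinity_const)
qed

lemma R_op_polynomial:
  assumes "k < n" "s \<le> m"
  obtains q where "weyl_act_fls (R_op m n) (poly_at_infinity (monom 1 k) * log_infinity ^ s) =
    poly_at_infinity q"
proof -
  let ?F = "monom (monom 1 k) s :: rat poly poly"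
  have "(pderiv ^^ (m + 1)) ?F = 0"
    using assms(2) by (intro poly_eqI) (simp add: coeff_higher_pderiv del: funpow.simps)
  moreover have "Fin (1 - int n) \<le> ord_infinity (poly_at_infinity (coeff ?F i))" for i
    using assms(1) by (auto simp: ord_infinity_ge_iff poly_at_infinity_nth)
  ultimately have "(T_log n ^^ m) ?F \<in> log_filtration n 1"
    by (intro T_log_power_filtration) (simp add: log_filtration_def)
  then obtain q where "(T_log n ^^ m) ?F = [:q:]"
    by (auto simp: log_filtration_def pderiv_eq_0_iff elim: degree_eq_zeroE)
  hence "weyl_act_fls (R_op m n) (eval_log ?F) = poly_at_infinity (smult (1 / fact n ^ m) q)"
    by (simp add: R_op_eval_log eval_log_pCons poly_at_infinity_smult)
  thus ?thesis
    by (intro that) (simp add: eval_log_monom)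
qed

section \<open>The remainders\<close>

text \<open>
  The coefficient is the residue of \<open>z\<^sup>k P L\<^sup>s\<close>, and integration by parts turns it into the residue of
  the polynomial \<open>z\<^sup>l R\<^sub>n (z\<^sup>k L\<^sup>s)\<close>.
\<close>

lemma P_pade_orthogonal:
  assumes "k < n" "s \<le> m"
  shows "(poly_at_infinity (P_pade m n l) * log_infinity ^ s) $$ (int k + 1) = 0"
proof -
  let ?z = "poly_at_infinity (monom 1 k)"
  obtain q where q: "weyl_act_fls (R_op m n) (?z * log_infinity ^ s) = poly_at_infinity q"
    using R_op_polynomial[OF assms] .
  have "?z = fls_X_inv ^ k"
    by (intro fls_eqI) (auto simp: poly_at_infinity_nth)
  hence "(poly_at_infinity (P_pade m n l) * log_infinity ^ s) $$ (int k + 1) =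
      (?z * (poly_at_infinity (P_pade m n l) * log_infinity ^ s)) $$ 1"
    by (simp add: fls_X_inv_power_times_conv_shift(1) add.commute)
  also have "\<dots> = (poly_at_infinity (P_pade m n l) * (?z * log_infinity ^ s)) $$ 1"
    by (simp add: mult_ac)
  also have "\<dots> = poly_at_infinity (monom 1 l * q) $$ 1"
    by (simp add: P_pade_def poly_at_infinity_weyl_act residue_weyl_adjoint q poly_at_infinity_mult)
  also have "\<dots> = 0"
    by (simp add: poly_at_infinity_nth)
  finally show ?thesis .
qed

text \<open>
  This is \<open>z p(z) - t p(t) = (z - t) p(z) + t (p(z) - p(t))\<close>; it gives the coefficients of the difference
  quotient by recursion on \<open>p\<close>.
\<close>

lemma difference_quotient_pCons:
  "difference_quotient (pCons a p) = pCons p (difference_quotient p)"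
proof -
  let ?d = "in_z [:0, 1:] - in_t [:0, 1:]"
  have d: "?d = [:[:0, 1:], - 1:]"
    by (simp add: in_z_def in_t_def map_poly_pCons one_pCons)
  have split: "pCons p (difference_quotient p) = [:p:] + pCons 0 (difference_quotient p)"
    by simp
  have "pCons p (difference_quotient p) * ?d =
      [:p:] * ?d + pCons 0 (difference_quotient p * ?d)"
    by (simp only: split distrib_right) simp
  also have "\<dots> = in_z (pCons a p) - in_t (pCons a p)"
    by (simp only: difference_quotient_mult) (simp add: d in_z_def in_t_def map_poly_pCons)
  also have "\<dots> = difference_quotient (pCons a p) * ?d"
    by (simp only: difference_quotient_mult)
  finally have "pCons p (difference_quotient p) * ?d = difference_quotient (pCons a p) * ?d" .
  moreover have "?d \<noteq> 0"
    by (simp add: d)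
  ultimately show ?thesis
    by (metis mult_right_cancel)
qed

lemma coeff_difference_quotient:
  "coeff (coeff (difference_quotient p) b) a = coeff p (Suc (a + b))"
proof (induction p arbitrary: b)
  case 0
  show ?case by (simp add: difference_quotient_def in_z_def in_t_def)
next
  case (pCons c p)
  thus ?case by (cases b) (simp_all add: difference_quotient_pCons)
qed

text \<open>
  The polynomial parts agree because both sides have the coefficient \<open>\<Sum>\<^sub>b f\<^sub>b p\<^sub>j\<^sub>+\<^sub>b\<^sub>+\<^sub>1\<close> at \<open>z\<^sup>j\<close>, where
  \<open>f\<^sub>b\<close> belongs to \<open>z\<^sup>-\<^sup>b\<^sup>-\<^sup>1\<close>. A constant term of \<open>f\<close> would contribute a multiple of \<open>p\<^sub>j\<close> on the right
  only, which is why it has to vanish.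
\<close>

lemma phi_difference_quotient:
  assumes "f $ 0 = 0" "i \<le> 0"
  shows "poly_at_infinity (phi f (difference_quotient p)) $$ i =
    (poly_at_infinity p * fps_to_fls f) $$ i"
proof -
  obtain j where i: "i = - int j"
    using assms(2) by (rule nonpos_int_cases)
  have "degree (difference_quotient p) \<le> degree p"
    by (intro degree_le) (auto intro: poly_eqI simp: coeff_difference_quotient coeff_eq_0)
  hence "phi f (difference_quotient p) =
      (\<Sum>b\<le>degree p. smult (f $ Suc b) (coeff (difference_quotient p) b))"
    unfolding phi_def by (intro sum.mono_neutral_left) (auto simp: coeff_eq_0)
  hence "poly_at_infinity (phi f (difference_quotient p)) $$ i =
      (\<Sum>b\<le>degree p. f $ Suc b * coeff p (Suc (j + b)))"
    by (simp add: poly_at_infinity_nth i coeff_sum coeff_difference_quotient)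
  \<comment> \<open>Substitute \<open>k = j + b + 1\<close>. The terms left unmatched are those with \<open>k > degree p\<close> on the left,
    where \<open>p\<close> has no coefficient, and those with \<open>k \<le> j\<close> on the right, where \<open>f\<close> vanishes.\<close>
  also have "\<dots> = (\<Sum>k\<le>degree p. coeff p k * fps_to_fls f $$ (i + int k))"
    by (rule sum.reindex_bij_witness_not_neutral[where S' = "{b. b \<le> degree p \<and> degree p \<le> j + b}"
          and T' = "{k. k \<le> degree p \<and> k \<le> j}" and j = "\<lambda>b. Suc (j + b)" and i = "\<lambda>k. k - Suc j"])
       (auto simp: i assms(1) coeff_eq_0 nat_add_distrib)
  also have "\<dots> = (poly_at_infinity p * fps_to_fls f) $$ i"
    by (simp only: poly_at_infinity_def sum_distrib_right fls_nth_sum mult.assoc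
        fls_X_inv_power_times_conv_shift(1)) simp
  finally show ?thesis .
qed

theorem corollary10p4:
  fixes m n l :: nat
  assumes "m \<ge> 1"
  shows "pade_type_approximant m n (\<lambda>s. log_series ^ s) (P_pade m n l) (\<lambda>s. Q_pade m n s l)"
proof -
  let ?P = "P_pade m n l"
  have "ord_infinity (poly_at_infinity ?P * fps_to_fls (log_series ^ s) -
      poly_at_infinity (Q_pade m n s l)) \<ge> Fin (int n + 1)" if s: "s \<in> {1..m}" for s
    unfolding ord_infinity_ge_iff
  proof (intro allI impI)
    fix i assume i: "i < int n + 1"
    show "(poly_at_infinity ?P * fps_to_fls (log_series ^ s) -
        poly_at_infinity (Q_pade m n s l)) $$ i = 0"
    proof (cases "i \<le> 0")
      case True
      have "(log_series ^ s) $ 0 = 0"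
        using s by (simp add: fps_nth_power_0 log_series_def)
      thus ?thesis
        using True by (simp add: Q_pade_def phi_difference_quotient)
    next
      case False
      then obtain k where "i = int k + 1" "k < n"
        using i that[of "nat (i - 1)"] by simp
      thus ?thesis
        using P_pade_orthogonal[of k n s m l] s
        by (simp add: poly_at_infinity_nth fps_to_fls_power)
    qed
  qed
  thus ?thesis
    unfolding pade_type_approximant_def
    by (intro exI[of _ "max (int m * int n) (int (degree ?P))"]) simp
qed

end
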